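(* Let $G_0\in\mathcal{L}_n$ be a connected signed graph on the vertex set $[n]$ with $n$ edges, and let $\mathcal{T}^{\mathcal{S}}$ be an $\mathcal{S}$-reduction tree with root labeled $G_0$. Then $$\operatorname{vol}_n(\mathcal{P}(G_0))=\frac{2f(G_0)}{n!},$$ where $f(G_0)$ denotes the number of leaves of $\mathcal{T}^{\mathcal{S}}$ labeled by graphs with $n$ edges.
   Context: A signed graph $G$ on $[n]=\{1,\dots,n\}$ is a finite multigraph (loops allowed) with each edge labeled $+$ or $-$; all loops are labeled $+$. An edge with endpoints $i,j$ and sign $\epsilon$ is written $(i,j,\epsilon)=(j,i,\epsilon)$. Let $e_1,\dots,e_n$ be the standard basis of $\mathbb{R}^n$. For $i\le j$ put $\mathrm{v}(i,j,-)=e_i-e_j$ (here $i<j$) and $\mathrm{v}(i,j,+)=e_i+e_j$ (so $\mathrm{v}(i,i,+)=2e_i$). Let $\Phi^+=\{e_i-e_j,\ e_i+e_j,\ 2e_k : 1\le i<j\le n,\ k\in[n]\}$. The cone $\mathcal{C}(G)$ is the set of nonnegative linear combinations of the vectors $\mathrm{v}(e)$, $e\in E(G)$. The root polytope is $\mathcal{P}(G)=\operatorname{ConvHull}(\{0\}\cup(\Phi^+\cap\mathcal{C}(G)))$. $\mathcal{L}_n$ is the set of signed graphs $G$ on $[n]$ for which the vectors $\mathrm{v}(e)$, $e\in E(G)$, are linearly independent. $\operatorname{vol}_n$ is $n$-dimensional Euclidean volume. Reductions. Each one takes two edges $a,b$ of a graph $G$ of the given form, and a third edge $c$, and produces three graphs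 on $[n]$ with edge sets $E(G)\setminus\{b\}\cup\{c\}$, $E(G)\setminus\{a\}\cup\{c\}$, $E(G)\setminus\{a,b\}\cup\{c\}$: (R1) $a=(i,j,-)$, $b=(j,k,-)$, $c=(i,k,-)$, for $i<j<k$; (R2) $a=(i,j,-)$, $b=(j,k,+)$, $c=(i,k,+)$, for $i<j<k$; (R3) $a=(i,k,-)$, $b=(j,k,+)$, $c=(i,j,+)$, for $i<j<k$; (R4) $a=(i,k,+)$, $b=(j,k,-)$, $c=(i,j,+)$, for $i<j<k$; (R5) $a=(i,j,-)$, $b=(i,j,+)$, $c=(i,i,+)$, for $i<j$; (R6) $a=(i,j,-)$, $b=(j,j,+)$, $c=(i,j,+)$, for $i<j$. An $\mathcal{S}$-reduction tree with root labeled $G_0$ is a rooted tree whose nodes are labeled by signed graphs, with root labeled $G_0$, in which each non-leaf node has three children labeled by the three graphs produced by some one of these reductions (any choice) applied to the graph at the node, and in which the leaves are labeled by graphs to which no reduction (R1)–(R6) can be applied. *)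

theory Defs
  imports "HOL-Analysis.Analysis" "HOL-Library.Multiset"
begin

text \<open>
  The vertex set \<open>[n]\<close> is rendered as an arbitrary finite linearly ordered index type \<open>'n\<close>
  with \<open>n = CARD('n)\<close>, so that \<open>\<real>\<^sup>n\<close> is \<open>real ^ 'n\<close> and \<open>e\<^sub>i\<close> is \<open>axis i 1\<close>.
\<close>

datatype sign = Positive | Negative

text \<open>
  The unordered edge with endpoints \<open>i\<close>, \<open>j\<close> and sign \<open>s\<close> is represented by its unique normal
  form \<open>(i, j, s)\<close> with \<open>i \<le> j\<close>; a graph is the multiset of its edges.
\<close>

type_synonym 'n edge = "'n \<times> 'n \<times> sign"
type_synonym 'n sgraph = "'n edge multiset"

definition signed_graph :: "'n::linorder sgraph \<Rightarrow> bool" where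
  "signed_graph G \<longleftrightarrow> (\<forall>(i, j, s) \<in> set_mset G. i \<le> j \<and> (i = j \<longrightarrow> s = Positive))"

definition connected_sgraph :: "'n sgraph \<Rightarrow> bool" where
  "connected_sgraph G \<longleftrightarrow> (\<forall>u v. equivclp (\<lambda>i j. \<exists>s. (i, j, s) \<in># G) u v)"

fun edge_vec :: "'n edge \<Rightarrow> real ^ 'n" where
  "edge_vec (i, j, Negative) = axis i 1 - axis j 1"
| "edge_vec (i, j, Positive) = axis i 1 + axis j 1"

definition positive_roots :: "(real ^ 'n::{finite,linorder}) set" where
  "positive_roots =
     {axis i 1 - axis j 1 | i j. i < j} \<union> {axis i 1 + axis j 1 | i j. i < j} \<union>
     {2 *\<^sub>R axis k 1 | k. True}"

definition edge_cone :: "'n::finite sgraph \<Rightarrow> (real ^ 'n) set" where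
  "edge_cone G =
     {(\<Sum>e\<in>set_mset G. c e *\<^sub>R edge_vec e) | c. \<forall>e\<in>set_mset G. (0::real) \<le> c e}"

definition root_polytope :: "'n::{finite,linorder} sgraph \<Rightarrow> (real ^ 'n::{finite,linorder}) set" where
  "root_polytope G = convex hull (insert 0 (positive_roots \<inter> edge_cone G))"

text \<open>
  Linear independence of the \<^emph>\<open>family\<close> of edge vectors: no vector is repeated in the family
  (in particular there are no repeated edges), and the vectors form an independent set.
\<close>

definition indep_sgraphs :: "'n::{finite,linorder} sgraph set" where
  "indep_sgraphs =
     {G. signed_graph G \<and>
         (\<forall>x. count (image_mset edge_vec G) x \<le> 1) \<and> independent (edge_vec ` set_mset G)}"

text \<open>\<open>reduction_rule a b c\<close>: the edges \<open>a\<close> and \<open>b\<close> are reducible, with new edge \<open>c\<close>.\<close>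

inductive reduction_rule :: "'n::linorder edge \<Rightarrow> 'n edge \<Rightarrow> 'n edge \<Rightarrow> bool" where
  R1: "i < j \<Longrightarrow> j < k \<Longrightarrow> reduction_rule (i, j, Negative) (j, k, Negative) (i, k, Negative)"
| R2: "i < j \<Longrightarrow> j < k \<Longrightarrow> reduction_rule (i, j, Negative) (j, k, Positive) (i, k, Positive)"
| R3: "i < j \<Longrightarrow> j < k \<Longrightarrow> reduction_rule (i, k, Negative) (j, k, Positive) (i, j, Positive)"
| R4: "i < j \<Longrightarrow> j < k \<Longrightarrow> reduction_rule (i, k, Positive) (j, k, Negative) (i, j, Positive)"
| R5: "i < j \<Longrightarrow> reduction_rule (i, j, Negative) (i, j, Positive) (i, i, Positive)"
| R6: "i < j \<Longrightarrow> reduction_rule (i, j, Negative) (j, j, Positive) (i, j, Positive)"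

definition reduces :: "'n::linorder sgraph \<Rightarrow> 'n sgraph \<Rightarrow> 'n sgraph \<Rightarrow> 'n sgraph \<Rightarrow> bool" where
  "reduces G G1 G2 G3 \<longleftrightarrow>
     (\<exists>a b c. reduction_rule a b c \<and> a \<in># G \<and> b \<in># G \<and>
        G1 = G - {#b#} + {#c#} \<and> G2 = G - {#a#} + {#c#} \<and> G3 = G - {#a, b#} + {#c#})"

datatype 'n rtree = Leaf "'n sgraph" | Node "'n sgraph" "'n rtree" "'n rtree" "'n rtree"

fun root_label :: "'n rtree \<Rightarrow> 'n sgraph" where
  "root_label (Leaf G) = G"
| "root_label (Node G _ _ _) = G"

fun S_reduction_tree :: "'n::linorder rtree \<Rightarrow> bool" where
  "S_reduction_tree (Leaf G) \<longleftrightarrow> \<not> (\<exists>G1 G2 G3. reduces G G1 G2 G3)"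
| "S_reduction_tree (Node G t1 t2 t3) \<longleftrightarrow>
     reduces G (root_label t1) (root_label t2) (root_label t3) \<and>
     S_reduction_tree t1 \<and> S_reduction_tree t2 \<and> S_reduction_tree t3"

text \<open>Labels of the leaves, one entry for each leaf.\<close>

fun leaf_labels :: "'n rtree \<Rightarrow> 'n sgraph multiset" where
  "leaf_labels (Leaf G) = {#G#}"
| "leaf_labels (Node _ t1 t2 t3) = leaf_labels t1 + leaf_labels t2 + leaf_labels t3"

definition num_full_leaves :: "'n::finite rtree \<Rightarrow> nat" where
  "num_full_leaves t = size {#G \<in># leaf_labels t. size G = CARD('n)#}"

end

theory Submission
  imports Defs
begin

text \<open>
  All positive roots have \<open>l\<^sub>1\<close>-norm 2, and \<open>\<P>(G)\<close> turns out to be the cone \<open>\<C>(G)\<close> cut off by the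
  \<open>l\<^sub>1\<close>-ball of radius 2. A reduction has \<open>v(c) = v(a) + v(b)\<close>, so it splits this truncated cone into
  those of the first two children, which overlap in a hyperplane, and it preserves the determinant
  of the edge vectors. At an irreducible graph every vertex is met by edge vectors of
  one sign only, so the \<open>l\<^sub>1\<close>-norm is linear on the cone and the truncated cone is the simplex spanned
  by 0 and the edge vectors. Hence the volume of \<open>\<P>(G\<^sub>0)\<close> is \<open>\<bar>d\<bar> f(G\<^sub>0) / n!\<close>, where \<open>d\<close> is the determinant
  of the edge vectors of \<open>G\<^sub>0\<close>. For a connected graph the edge vectors generate the index-2 lattice of
  integer vectors with even coordinate sum, whence \<open>\<bar>d\<bar> = 2\<close>.
\<close>

subsection \<open>Volume of a simplex\<close>

text \<open>
  The change-of-variables theorems of the library require the coordinates to be indexed by a type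
  of class \<open>wellorder\<close>. A type variable of class \<open>{finite, linorder}\<close> cannot be declared an instance,
  but this isomorphic copy can.
\<close>

typedef 'a wo = "UNIV :: 'a set" ..

instance wo :: (finite) finite
proof
  have "(UNIV :: 'a wo set) = Abs_wo ` UNIV"
    by (metis type_definition.Abs_image type_definition_wo)
  then show "finite (UNIV :: 'a wo set)"
    by (metis finite finite_imageI)
qed

instantiation wo :: (linorder) linorder
begin

definition less_eq_wo :: "'a wo \<Rightarrow> 'a wo \<Rightarrow> bool" where
  "less_eq_wo x y \<longleftrightarrow> Rep_wo x \<le> Rep_wo y"

definition less_wo :: "'a wo \<Rightarrow> 'a wo \<Rightarrow> bool" where
  "less_wo x y \<longleftrightarrow> Rep_wo x < Rep_wo y"

instance
  by standard (auto simp: less_eq_wo_def less_wo_def Rep_wo_inject[symmetric])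

end

instance wo :: ("{finite,linorder}") wellorder
proof
  fix P :: "'a wo \<Rightarrow> bool" and a
  assume step: "\<And>x. (\<And>y. y < x \<Longrightarrow> P y) \<Longrightarrow> P x"
  have "trans {(x, y :: 'a wo). x < y}"
    by (auto intro: transI)
  then have "acyclic {(x, y :: 'a wo). x < y}"
    by (simp add: acyclic_irrefl trancl_id irrefl_def)
  then have "wf {(x, y :: 'a wo). x < y}"
    by (simp add: finite_acyclic_wf)
  then show "P a"
    by (induction a rule: wf_induct_rule) (auto intro: step)
qed

section \<open>Invariance of determinants and volumes under renaming coordinates\<close>

lemma bij_Rep_wo: "bij Rep_wo"
  by (metis Rep_wo_inject Rep_wo_inverse Abs_wo_inverse UNIV_I bij_def inj_def surj_def)

text \<open>Conjugation by \<open>\<pi>\<close> matches the permutations of the two index types and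
  preserves signs, so the two Leibniz sums agree term by term.\<close>

lemma det_reindex:
  fixes A :: "'a::comm_ring_1 ^ 'n ^ 'n" and \<pi> :: "'m::finite \<Rightarrow> 'n"
  assumes "bij \<pi>"
  shows "det (\<chi> k l. A $ \<pi> k $ \<pi> l) = det A"
proof -
  have "bij_betw (map_permutation UNIV \<pi>) {p. p permutes UNIV} {p. p permutes UNIV}"
  proof (rule bij_betw_byWitness[where f' = "map_permutation UNIV (inv \<pi>)"])
    show "\<forall>p\<in>{p. p permutes UNIV}. map_permutation UNIV (inv \<pi>) (map_permutation UNIV \<pi> p) = p"
      using assms by (auto simp: map_permutation_def restrict_id_def bij_is_surj bij_is_inj
          bij_imp_bij_inv inv_inv_eq fun_eq_iff)
    show "\<forall>p\<in>{p. p permutes UNIV}. map_permutation UNIV \<pi> (map_permutation UNIV (inv \<pi>) p) = p"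
      using assms by (auto simp: map_permutation_def restrict_id_def bij_is_surj bij_is_inj
          bij_imp_bij_inv inv_inv_eq fun_eq_iff surj_f_inv_f)
    show "map_permutation UNIV \<pi> ` {p. p permutes UNIV} \<subseteq> {p. p permutes UNIV}"
      using assms by (auto intro: map_permutation_permutes)
    show "map_permutation UNIV (inv \<pi>) ` {p. p permutes UNIV} \<subseteq> {p. p permutes UNIV}"
      using assms bij_imp_bij_inv by (auto intro!: map_permutation_permutes)
  qed
  then have "det A = (\<Sum>p | p permutes (UNIV::'m set).
      of_int (sign (map_permutation UNIV \<pi> p)) * (\<Prod>i\<in>UNIV. A $ i $ map_permutation UNIV \<pi> p i))"
    unfolding det_def by (subst sum.reindex_bij_betw[symmetric]) auto
  also have "\<dots> = (\<Sum>p | p permutes (UNIV::'m set).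
      of_int (sign p) * (\<Prod>k\<in>UNIV. A $ \<pi> k $ \<pi> (p k)))"
  proof (intro sum.cong refl, goal_cases)
    case (1 p)
    have "(\<Prod>i\<in>UNIV. A $ i $ map_permutation UNIV \<pi> p i)
        = (\<Prod>k\<in>UNIV. A $ \<pi> k $ map_permutation UNIV \<pi> p (\<pi> k))"
      using assms by (subst prod.reindex_bij_betw[symmetric, of \<pi>]) auto
    then show ?case
      using 1 assms by (simp add: sign_map_permutation bij_is_inj map_permutation_apply)
  qed
  finally show ?thesis
    by (simp add: det_def)
qed

lemma prod_Basis_cart:
  fixes x :: "real ^ 'n"
  shows "(\<Prod>b\<in>Basis. x \<bullet> b) = (\<Prod>i\<in>UNIV. x $ i)"
  by (simp add: Basis_vec_def cart_eq_inner_axis axis_eq_axis prod.UNION_disjoint)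

text \<open>Renaming coordinates turns boxes into boxes with the same side lengths, and Lebesgue
  measure is determined by its values on boxes.\<close>

lemma measure_lborel_reindex:
  fixes \<pi> :: "'m::finite \<Rightarrow> 'n::finite" and S :: "(real ^ 'm) set"
  assumes "bij \<pi>" "S \<in> sets borel"
  shows "measure lborel ((\<lambda>x. \<chi> k. x $ \<pi> k) -` S) = measure lborel S"
proof -
  let ?\<rho> = "\<lambda>x :: real ^ 'n. \<chi> k. x $ \<pi> k"
  let ?\<sigma> = "\<lambda>y :: real ^ 'm. \<chi> i. y $ inv \<pi> i"
  have "linear ?\<rho>"
    by (rule linearI) (auto simp: vec_eq_iff)
  then have meas [measurable]: "?\<rho> \<in> borel_measurable borel"
    by (intro borel_measurable_continuous_onI linear_continuous_on linear_conv_bounded_linear[THEN iffD1])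
  have "lborel = distr lborel borel ?\<rho>"
  proof (rule lborel_eqI)
    fix l u :: "real ^ 'm"
    assume "\<And>b. b \<in> Basis \<Longrightarrow> l \<bullet> b \<le> u \<bullet> b"
    then have le: "l $ k \<le> u $ k" for k
      by (auto simp: cart_eq_inner_axis)
    have "?\<rho> -` box l u = box (?\<sigma> l) (?\<sigma> u)"
      using assms(1) unfolding mem_box_cart set_eq_iff vimage_def mem_Collect_eq vec_lambda_beta
      by (metis (mono_tags, lifting) bij_inv_eq_iff)
    then have "emeasure (distr lborel borel ?\<rho>) (box l u) = emeasure lborel (box (?\<sigma> l) (?\<sigma> u))"
      by (simp add: emeasure_distr)
    also have "\<dots> = (\<Prod>i\<in>UNIV. (?\<sigma> u - ?\<sigma> l) $ i)"
    proof (subst emeasure_lborel_box)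
      show "?\<sigma> l \<bullet> b \<le> ?\<sigma> u \<bullet> b" if "b \<in> Basis" for b
        using that le by (auto simp: Basis_vec_def inner_axis)
    qed (simp only: prod_Basis_cart)
    also have "\<dots> = (\<Prod>k\<in>UNIV. (u - l) $ k)"
      using assms(1) by (subst prod.reindex_bij_betw[symmetric, of \<pi>]) (auto simp: bij_is_inj)
    finally show "emeasure (distr lborel borel ?\<rho>) (box l u) = (\<Prod>b\<in>Basis. (u - l) \<bullet> b)"
      by (simp add: prod_Basis_cart)
  qed simp
  then have "measure lborel S = measure (distr lborel borel ?\<rho>) S"
    by simp
  then show ?thesis
    using assms(2) by (simp add: measure_distr)
qed

lemma inj_of_det:
  fixes v :: "'n::finite \<Rightarrow> real ^ 'n"
  assumes "det (\<chi> k. v k) \<noteq> 0"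
  shows "inj v"
proof (rule injI, rule ccontr)
  fix i j assume "v i = v j" "i \<noteq> j"
  then show False
    using assms det_identical_rows[of i j "\<chi> i. v i"] by (simp add: row_def)
qed

text \<open>The simplex is carried to coordinates indexed by \<open>'n wo\<close>, where
  \<open>content_simplex\<close> applies; renaming changes neither its volume nor the
  determinant.\<close>

lemma measure_simplex:
  fixes v :: "'n::{finite,linorder} \<Rightarrow> real ^ 'n::{finite,linorder}"
  assumes "det (\<chi> i. v i) \<noteq> 0"
  shows "measure lebesgue (convex hull (insert 0 (range v))) = \<bar>det (\<chi> i. v i)\<bar> / fact CARD('n)"
proof -
  let ?\<rho> = "\<lambda>x :: (real, 'n) vec. \<chi> k :: 'n wo. x $ Rep_wo k"
  let ?w = "\<lambda>k. ?\<rho> (v (Rep_wo k))"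
  have lin: "linear ?\<rho>"
    by (rule linearI) (auto simp: vec_eq_iff)
  have inj\<rho>: "inj ?\<rho>"
  proof (rule injI)
    fix x y :: "(real, 'n) vec" assume "?\<rho> x = ?\<rho> y"
    then have "x $ Rep_wo k = y $ Rep_wo k" for k
      by (simp add: vec_eq_iff)
    from this[of "Abs_wo _"] show "x = y"
      by (simp add: Abs_wo_inverse vec_eq_iff)
  qed
  have "inj v"
    using assms by (rule inj_of_det)
  have v_nz: "v i \<noteq> 0" for i
    using assms det_zero_row(1)[of i "\<chi> i. v i"] by (auto simp: row_def vec_eq_iff)
  have "inj (Rep_wo :: 'n wo \<Rightarrow> 'n)"
    using bij_Rep_wo by (rule bij_is_inj)
  from inj_compose[OF inj\<rho> inj_compose[OF \<open>inj v\<close> this]] have inj: "inj ?w"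
    by (simp only: o_def)
  have nz: "0 \<notin> range ?w"
  proof
    assume "0 \<in> range ?w"
    then obtain k where "?\<rho> (v (Rep_wo k)) = ?\<rho> 0"
      using linear_0[OF lin] by fastforce
    then show False
      using inj\<rho> v_nz by (meson injD)
  qed
  have card: "CARD('n wo) = CARD('n)"
    using bij_Rep_wo bij_betw_same_card by blast
  have hull: "?\<rho> ` (convex hull (insert 0 (range v))) = convex hull (insert 0 (range ?w))"
  proof -
    have "?\<rho> ` (convex hull (insert 0 (range v))) = convex hull (?\<rho> ` insert 0 (range v))"
      using lin by (rule convex_hull_linear_image)
    also have "?\<rho> ` insert 0 (range v) = insert 0 (?\<rho> ` v ` range Rep_wo)"
      by (simp add: linear_0[OF lin] bij_is_surj[OF bij_Rep_wo] zero_vec_def)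
    also have "?\<rho> ` v ` range Rep_wo = range ?w"
      by (simp add: image_image)
    finally show ?thesis .
  qed
  have cpt: "compact (convex hull (insert 0 (range v)))"
    "compact (convex hull (insert 0 (range ?w)))"
    by (auto intro: finite_imp_compact_convex_hull)
  have "measure lebesgue (convex hull (insert 0 (range v)))
      = measure lborel (convex hull (insert 0 (range v)))"
    using cpt by (simp add: measure_completion compact_imp_closed borel_closed)
  also have "\<dots> = measure lborel (?\<rho> -` (convex hull (insert 0 (range ?w))))"
    unfolding hull[symmetric] inj_vimage_image_eq[OF inj\<rho>] ..
  also have "\<dots> = measure lborel (convex hull (insert 0 (range ?w)))"
    using bij_Rep_wo cpt by (intro measure_lborel_reindex) (auto simp: compact_imp_closed borel_closed)
  also have "\<dots> = \<bar>det (\<chi> i j. ?w j $ i - 0 $ i)\<bar> / fact CARD('n wo)"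
    using inj nz by (intro content_simplex)
      (auto simp: card_insert_if card_image bij_betw_def)
  \<comment> \<open>\<open>content_simplex\<close> puts the vertices into columns, while here they
    are rows.\<close>
  also have "(\<chi> i j. ?w j $ i - 0 $ i) = transpose (\<chi> k l. (\<chi> i. v i) $ Rep_wo k $ Rep_wo l)"
    by (simp add: transpose_def)
  also have "det \<dots> = det (\<chi> i. v i)"
    unfolding det_transpose by (rule det_reindex[OF bij_Rep_wo])
  finally show ?thesis
    by (simp add: card)
qed

subsection \<open>Determinant of a connected signed graph\<close>

text \<open>The lattice generated by the rows. Integers are kept as reals so that all determinants
  have the same type.\<close>

definition int_row_span :: "real ^ 'n ^ 'm \<Rightarrow> (real ^ 'n) set" where
  "int_row_span A = {\<Sum>i\<in>UNIV. z i *\<^sub>R A $ i | z. \<forall>i. z i \<in> \<int>}"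

lemma int_row_span_row: "A $ i \<in> int_row_span A"
  unfolding int_row_span_def
  by (rule CollectI, rule exI[of _ "\<lambda>j. if j = i then 1 else 0"]) (simp add: if_distribR if_distrib cong: if_cong)

lemma int_row_span_add:
  assumes "x \<in> int_row_span A" "y \<in> int_row_span A"
  shows "x + y \<in> int_row_span A"
proof -
  obtain z w where zw: "\<forall>i. z i \<in> \<int>" "\<forall>i. w i \<in> \<int>"
      and "x = (\<Sum>i\<in>UNIV. z i *\<^sub>R A $ i)" "y = (\<Sum>i\<in>UNIV. w i *\<^sub>R A $ i)"
    using assms unfolding int_row_span_def by blast
  then have "x + y = (\<Sum>i\<in>UNIV. (z i + w i) *\<^sub>R A $ i)"
    by (simp add: scaleR_left_distrib sum.distrib)
  with zw show ?thesis
    unfolding int_row_span_def by (auto intro!: exI[of _ "\<lambda>i. z i + w i"])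
qed

lemma int_row_span_scale:
  assumes "x \<in> int_row_span A" "c \<in> \<int>"
  shows "c *\<^sub>R x \<in> int_row_span A"
proof -
  obtain z where z: "\<forall>i. z i \<in> \<int>" and "x = (\<Sum>i\<in>UNIV. z i *\<^sub>R A $ i)"
    using assms unfolding int_row_span_def by blast
  then have "c *\<^sub>R x = (\<Sum>i\<in>UNIV. (c * z i) *\<^sub>R A $ i)"
    by (simp add: scaleR_sum_right)
  with z assms(2) show ?thesis
    unfolding int_row_span_def by (auto intro!: exI[of _ "\<lambda>i. c * z i"])
qed

lemma int_row_span_zero: "0 \<in> int_row_span A"
  using int_row_span_scale[OF int_row_span_row, of 0] by simp

lemma det_int:
  fixes Z :: "real ^ 'n ^ 'n"
  assumes "\<And>i j. Z $ i $ j \<in> \<int>"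
  shows "det Z \<in> \<int>"
  unfolding det_def using assms by (intro Ints_sum Ints_mult Ints_prod) auto

text \<open>Here \<open>B = Z ** A\<close> for an integer matrix \<open>Z\<close>. Applied in both
  directions, this shows that two matrices whose rows span the same lattice have the same
  determinant up to sign.\<close>

lemma det_int_row_span:
  fixes A B :: "real ^ 'n ^ 'n"
  assumes "\<And>i. B $ i \<in> int_row_span A"
  obtains k where "k \<in> \<int>" "det B = k * det A"
proof -
  have "\<forall>i. \<exists>z. (\<forall>j. z j \<in> \<int>) \<and> B $ i = (\<Sum>j\<in>UNIV. z j *\<^sub>R A $ j)"
    using assms unfolding int_row_span_def by blast
  then obtain z where z: "\<And>i j. z i j \<in> \<int>" and B: "\<And>i. B $ i = (\<Sum>j\<in>UNIV. z i j *\<^sub>R A $ j)"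
    by metis
  let ?Z = "\<chi> i j. z i j"
  have "B = ?Z ** A"
    by (simp add: vec_eq_iff B matrix_matrix_mult_def)
  then have "det B = det ?Z * det A"
    by (simp add: det_mul)
  moreover have "det ?Z \<in> \<int>"
    by (rule det_int) (simp add: z)
  ultimately show ?thesis
    using that by blast
qed

fun sign_val :: "sign \<Rightarrow> real" where
  "sign_val Positive = 1"
| "sign_val Negative = -1"

lemma sign_val_cases: "sign_val t \<in> {1, -1}"
  by (cases t) auto

lemma edge_vec_sign_val: "edge_vec (i, j, t) = axis i 1 + sign_val t *\<^sub>R axis j 1"
  by (cases t) auto

text \<open>A reference matrix \<open>B\<close> with determinant 2 up to sign is shown to span the
  same lattice as the edge vectors. Its rows \<open>axis r 1 + s j *\<^sub>R axis j 1\<close> come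
  from walks starting at a fixed vertex \<open>r\<close>, and its row
  \<open>2 *\<^sub>R axis r 1\<close> from the nonzero determinant.\<close>

lemma det_connected:
  fixes f :: "'n::finite \<Rightarrow> 'n edge"
  assumes conn: "\<And>u v. equivclp (\<lambda>i j. \<exists>t. (i, j, t) \<in> range f) u v"
    and nz: "det (\<chi> k. edge_vec (f k)) \<noteq> 0"
  shows "\<bar>det (\<chi> k. edge_vec (f k))\<bar> = 2"
proof -
  let ?M = "\<chi> k. edge_vec (f k)"
  let ?L = "int_row_span ?M"
  have row: "edge_vec e \<in> ?L" if "e \<in> range f" for e
    using that int_row_span_row[of ?M] by auto
  obtain r :: 'n where True by simp
  \<comment> \<open>Induction along a walk from \<open>r\<close>: each further edge vector is added
    with the sign that cancels the previous endpoint. The empty walk gives the zero vector.\<close>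
  have "\<exists>s. s \<in> {1, -1} \<and> axis r 1 + s *\<^sub>R axis j 1 \<in> ?L" for j
    using conn[of r j]
  proof (induction rule: equivclp_induct)
    case base
    show ?case
      using int_row_span_zero[of ?M] by (intro exI[of _ "-1"]) simp
  next
    case (step i j)
    from step.IH obtain s where s: "s \<in> {1, -1}" and L: "axis r 1 + s *\<^sub>R axis i 1 \<in> ?L"
      by blast
    from step.hyps(2) obtain t where "(i, j, t) \<in> range f \<or> (j, i, t) \<in> range f"
      by auto
    then obtain u where u: "u \<in> {1, -1}" and e: "axis i 1 + u *\<^sub>R axis j 1 \<in> ?L"
    proof
      assume "(i, j, t) \<in> range f"
      then show ?thesis
        using that[of "sign_val t"] row[of "(i, j, t)"] sign_val_cases[of t]
        by (simp add: edge_vec_sign_val)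
    next
      assume "(j, i, t) \<in> range f"
      \<comment> \<open>An edge traversed backwards: since the sign squares to 1, scaling by it
        moves it to the other endpoint.\<close>
      then have "sign_val t *\<^sub>R (axis j 1 + sign_val t *\<^sub>R axis i 1) \<in> ?L"
        using row[of "(j, i, t)"] sign_val_cases[of t]
        by (intro int_row_span_scale) (auto simp: edge_vec_sign_val)
      also have "sign_val t *\<^sub>R (axis j 1 + sign_val t *\<^sub>R axis i 1) = axis i 1 + sign_val t *\<^sub>R axis j 1"
        using sign_val_cases[of t] by (auto simp: algebra_simps)
      finally show ?thesis
        using that[of "sign_val t"] sign_val_cases[of t] by blast
    qed
    have "(axis r 1 + s *\<^sub>R axis i 1) + (- s) *\<^sub>R (axis i 1 + u *\<^sub>R axis j 1) \<in> ?L"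
      using s by (intro int_row_span_add[OF L] int_row_span_scale[OF e]) auto
    also have "(axis r 1 + s *\<^sub>R axis i 1) + (- s) *\<^sub>R (axis i 1 + u *\<^sub>R axis j 1)
        = axis r 1 + (- s * u) *\<^sub>R axis j (1::real)"
      by (simp add: algebra_simps)
    finally show ?case
      using s u by (intro exI[of _ "- s * u"]) auto
  qed
  then obtain s' where s': "\<And>j. s' j \<in> {1, -1}" "\<And>j. axis r 1 + s' j *\<^sub>R axis j 1 \<in> ?L"
    by metis
  \<comment> \<open>The walk may have given sign 1 at \<open>r\<close>. With -1 the vector at
    \<open>r\<close> is zero, so row \<open>r\<close> of \<open>B\<close> is free for
    \<open>2 *\<^sub>R axis r 1\<close>.\<close>
  define s where "s = s'(r := -1 :: real)"
  have s: "s j \<in> {1, -1}" and sL: "axis r 1 + s j *\<^sub>R axis j 1 \<in> ?L" for j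
    using s' int_row_span_zero[of ?M] by (auto simp: s_def)
  have sr: "s r = -1"
    by (simp add: s_def)
  define B :: "real ^ 'n ^ 'n" where
    "B = (\<chi> j. if j = r then 2 *\<^sub>R axis r 1 else axis r 1 + s j *\<^sub>R axis j 1)"

  \<comment> \<open>Adding multiples of the other columns of a diagonal matrix to column \<open>r\<close> gives \<open>B\<close>.\<close>
  have "\<bar>det B\<bar> = 2"
  proof -
    let ?D = "\<chi> i j. if i = j then if i = r then 2 else s i else (0::real)"
    let ?x = "\<chi> i. if i = r then 1 else s i"
    have Dx: "(?D *v ?x) $ i = (if i = r then 2 else 1)" for i
    proof -
      have "(?D *v ?x) $ i = (\<Sum>j\<in>UNIV. if i = j then (if i = r then 2 else s i) * ?x $ j else 0)"
        unfolding matrix_vector_mult_def vec_lambda_beta by (intro sum.cong refl) simp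
      then show ?thesis
        using s[of i] by (auto simp: sum.delta)
    qed
    have "B = (\<chi> i j. if j = r then (?D *v ?x) $ i else ?D $ i $ j)"
      unfolding Dx by (simp add: B_def vec_eq_iff axis_def)
    then have "det B = det ?D"
      using cramer_lemma[of r ?D ?x] by simp
    also have "\<dots> = (\<Prod>i\<in>UNIV. if i = r then 2 else s i)"
      by (subst det_diagonal) auto
    finally have "\<bar>det B\<bar> = (\<Prod>i\<in>UNIV. \<bar>if i = r then 2 else s i\<bar>)"
      by (simp add: abs_prod)
    also have "\<dots> = (\<Prod>i\<in>UNIV. if i = r then 2 else 1)"
    proof (intro prod.cong refl)
      show "\<bar>if i = r then 2 else s i\<bar> = (if i = r then 2 else 1)" for i
        using s[of i] by auto
    qed
    finally show ?thesis
      by simp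
  qed

  \<comment> \<open>Every edge vector is a signed sum of the walk vectors of its endpoints, up to a
    multiple of \<open>axis r 1\<close> whose coefficient is 0, 2 or -2 when \<open>u\<close> is a
    sign.\<close>
  have edge: "axis a 1 + u *\<^sub>R axis b 1
      = s a *\<^sub>R (axis r 1 + s a *\<^sub>R axis a 1) + (u * s b) *\<^sub>R (axis r 1 + s b *\<^sub>R axis b 1)
        - (s a + u * s b) *\<^sub>R axis r (1::real)" for a b u
  proof -
    have "s a * s a = 1" "s b * s b = 1"
      using s[of a] s[of b] by auto
    then show ?thesis
      by (simp add: algebra_simps)
  qed

  have r2: "2 *\<^sub>R axis r 1 \<in> ?L"
  proof -
    \<comment> \<open>Were \<open>s\<close> orthogonal to all edge vectors, it would be a nonzero
      kernel vector. So for some edge the leftover coefficient of \<open>axis r 1\<close> is 2 or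
      -2.\<close>
    obtain k where k: "(?M *v (\<chi> i. s i)) $ k \<noteq> 0"
    proof (rule ccontr)
      assume "\<not> thesis"
      with that have "?M *v (\<chi> i. s i) = ?M *v 0"
        by (auto simp: vec_eq_iff)
      moreover have "inj ((*v) ?M)"
        using nz by (simp add: inj_matrix_vector_mult invertible_det_nz)
      ultimately have "(\<chi> i. s i) = 0"
        by (meson injD)
      then show False
        using sr by (auto simp: vec_eq_iff)
    qed
    obtain a b t where fk: "f k = (a, b, t)"
      by (cases "f k")
    let ?u = "sign_val t"
    have "(?M *v (\<chi> i. s i)) $ k = s a + ?u * s b"
      by (simp add: matrix_vector_mul_component inner_commute fk edge_vec_sign_val inner_add_right inner_axis)
    with k have c: "s a + ?u * s b \<in> {2, -2}"
      using s[of a] s[of b] sign_val_cases[of t] by auto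
    define c where "c = s a + ?u * s b"
    \<comment> \<open>The bracket equals \<open>c *\<^sub>R axis r 1\<close>; the factor
      \<open>c / 2\<close> is a sign that turns this into
      \<open>2 *\<^sub>R axis r 1\<close>.\<close>
    have "(c / 2) *\<^sub>R (s a *\<^sub>R (axis r 1 + s a *\<^sub>R axis a 1) + (?u * s b) *\<^sub>R (axis r 1 + s b *\<^sub>R axis b 1)
        + (-1) *\<^sub>R (axis a 1 + ?u *\<^sub>R axis b 1)) \<in> ?L"
      using s[of a] s[of b] sign_val_cases[of t] row[OF rangeI, of k] c
      by (intro int_row_span_scale[OF int_row_span_add[OF int_row_span_add]] int_row_span_scale[OF sL]
          int_row_span_scale[where x = "axis a 1 + ?u *\<^sub>R axis b 1"])
        (auto simp: fk edge_vec_sign_val c_def)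
    also have "s a *\<^sub>R (axis r 1 + s a *\<^sub>R axis a 1) + (?u * s b) *\<^sub>R (axis r 1 + s b *\<^sub>R axis b 1)
        + (-1) *\<^sub>R (axis a 1 + ?u *\<^sub>R axis b 1) = c *\<^sub>R axis r (1::real)"
      by (subst edge[of a ?u b]) (simp add: c_def)
    also have "(c / 2) *\<^sub>R c *\<^sub>R axis r (1::real) = 2 *\<^sub>R axis r 1"
      using c by (auto simp: c_def)
    finally show ?thesis .
  qed

  have "B $ j \<in> ?L" for j
    using r2 sL by (simp add: B_def)
  then obtain k where k: "k \<in> \<int>" "det B = k * det ?M"
    by (rule det_int_row_span)
  have Br: "2 *\<^sub>R axis r 1 \<in> int_row_span B"
    using int_row_span_row[of B r] by (simp add: B_def)
  have Bj: "axis r 1 + s j *\<^sub>R axis j 1 \<in> int_row_span B" for j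
    using int_row_span_row[of B j] int_row_span_zero[of B] by (cases "j = r") (auto simp: B_def sr)
  have "?M $ m \<in> int_row_span B" for m
  proof -
    obtain a b t where fm: "f m = (a, b, t)"
      by (cases "f m")
    let ?u = "sign_val t"
    \<comment> \<open>A sum of two signs is even, so the leftover is an integer multiple of row
      \<open>r\<close> of \<open>B\<close>.\<close>
    have c: "- (s a + ?u * s b) / 2 \<in> \<int>"
      using s[of a] s[of b] sign_val_cases[of t] by auto
    have "s a *\<^sub>R (axis r 1 + s a *\<^sub>R axis a 1) + (?u * s b) *\<^sub>R (axis r 1 + s b *\<^sub>R axis b 1)
        + (- (s a + ?u * s b) / 2) *\<^sub>R (2 *\<^sub>R axis r 1) \<in> int_row_span B"
      using c s[of a] s[of b] sign_val_cases[of t]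
      by (intro int_row_span_add[OF int_row_span_add] int_row_span_scale[OF Bj] int_row_span_scale[OF Br]) auto
    also have "s a *\<^sub>R (axis r 1 + s a *\<^sub>R axis a 1) + (?u * s b) *\<^sub>R (axis r 1 + s b *\<^sub>R axis b 1)
        + (- (s a + ?u * s b) / 2) *\<^sub>R (2 *\<^sub>R axis r 1) = axis a 1 + ?u *\<^sub>R axis b (1::real)"
      by (subst edge[of a ?u b]) (simp add: diff_divide_distrib flip: scaleR_minus_left)
    finally show ?thesis
      by (simp add: fm edge_vec_sign_val)
  qed
  then obtain l where l: "l \<in> \<int>" "det ?M = l * det B"
    by (rule det_int_row_span)
  have "k * l = 1"
    using k(2) l(2) \<open>\<bar>det B\<bar> = 2\<close> by auto
  moreover obtain k' l' :: int where "k = of_int k'" "l = of_int l'"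
    using k(1) l(1) by (elim Ints_cases)
  ultimately have "k' * l' = 1"
    by (metis of_int_1 of_int_eq_iff of_int_mult)
  then have "\<bar>l\<bar> = 1"
    using \<open>l = of_int l'\<close> by (auto simp: zmult_eq_1_iff)
  then show ?thesis
    using l(2) \<open>\<bar>det B\<bar> = 2\<close> by (simp add: abs_mult)
qed

subsection \<open>Truncated cones\<close>

definition l1norm :: "real ^ 'n \<Rightarrow> real" where
  "l1norm x = (\<Sum>i\<in>UNIV. \<bar>x $ i\<bar>)"

lemma l1norm_add_le: "l1norm (x + y) \<le> l1norm x + l1norm y"
  unfolding l1norm_def sum.distrib[symmetric] by (intro sum_mono) (simp add: abs_triangle_ineq)

lemma l1norm_scale: "l1norm (c *\<^sub>R x) = \<bar>c\<bar> * l1norm x"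
  by (simp add: l1norm_def abs_mult sum_distrib_left)

text \<open>Indexing the generators makes the replacement of one of them a function update.\<close>

definition nonneg_cone :: "('i::finite \<Rightarrow> 'a::real_vector) \<Rightarrow> 'a set" where
  "nonneg_cone v = {\<Sum>k\<in>UNIV. c k *\<^sub>R v k | c. \<forall>k. 0 \<le> c k}"

lemma nonneg_coneI: "(\<And>k. 0 \<le> c k) \<Longrightarrow> x = (\<Sum>k\<in>UNIV. c k *\<^sub>R v k) \<Longrightarrow> x \<in> nonneg_cone v"
  unfolding nonneg_cone_def by blast

lemma convex_nonneg_cone: "convex (nonneg_cone v)"
proof (rule convexI)
  fix x y and s t :: real
  assume "x \<in> nonneg_cone v" "y \<in> nonneg_cone v" and st: "0 \<le> s" "0 \<le> t"
  then obtain c d where "\<forall>k. 0 \<le> c k" "\<forall>k. 0 \<le> d k"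
      and "x = (\<Sum>k\<in>UNIV. c k *\<^sub>R v k)" "y = (\<Sum>k\<in>UNIV. d k *\<^sub>R v k)"
    unfolding nonneg_cone_def by blast
  with st show "s *\<^sub>R x + t *\<^sub>R y \<in> nonneg_cone v"
    by (intro nonneg_coneI[of "\<lambda>k. s * c k + t * d k"])
      (auto simp: scaleR_sum_right scaleR_left_distrib sum.distrib)
qed

lemma generator_in_nonneg_cone: "v k \<in> nonneg_cone v"
  by (rule nonneg_coneI[of "\<lambda>l. if l = k then 1 else 0"]) (auto simp: if_distribR if_distrib cong: if_cong)

text \<open>A coefficient \<open>c q\<close> of the new generator counts for both \<open>v p\<close>
  and \<open>v q\<close>. In old coefficients this means \<open>d p = c p + c q\<close> and
  \<open>d q = c q\<close>, so nonnegativity of \<open>c p\<close> becomes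
  \<open>d q \<le> d p\<close>.\<close>

lemma nonneg_cone_update_sum:
  fixes v :: "'i::finite \<Rightarrow> 'a::real_vector"
  assumes "p \<noteq> q"
  shows "nonneg_cone (v(q := v p + v q)) =
    {\<Sum>k\<in>UNIV. d k *\<^sub>R v k | d. (\<forall>k. 0 \<le> d k) \<and> d q \<le> d p}"
proof -
  have split: "(\<Sum>k\<in>UNIV. g k) = g p + g q + (\<Sum>k\<in>UNIV - {p, q}. g k)" for g :: "'i \<Rightarrow> 'a"
    using assms by (subst sum.subset_diff[of "{p, q}"]) auto
  have "(\<Sum>k\<in>UNIV. c k *\<^sub>R (v(q := v p + v q)) k) = (\<Sum>k\<in>UNIV. (c(p := c p + c q)) k *\<^sub>R v k)" for c
    unfolding split using assms by (auto simp: algebra_simps intro!: sum.cong)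
  then have eq: "nonneg_cone (v(q := v p + v q)) =
      {\<Sum>k\<in>UNIV. (c(p := c p + c q)) k *\<^sub>R v k | c. \<forall>k. 0 \<le> c k}"
    unfolding nonneg_cone_def by simp
  show ?thesis
    unfolding eq
  proof (intro equalityI subsetI; elim CollectE exE conjE)
    fix x c
    assume "x = (\<Sum>k\<in>UNIV. (c(p := c p + c q)) k *\<^sub>R v k)" "\<forall>k. 0 \<le> c k"
    then show "x \<in> {\<Sum>k\<in>UNIV. d k *\<^sub>R v k | d. (\<forall>k. 0 \<le> d k) \<and> d q \<le> d p}"
      using assms by (intro CollectI exI[of _ "c(p := c p + c q)"]) auto
  next
    fix x d
    assume d: "x = (\<Sum>k\<in>UNIV. d k *\<^sub>R v k)" "\<forall>k. 0 \<le> d k" "d q \<le> d p"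
    let ?c = "d(p := d p - d q)"
    have "?c(p := ?c p + ?c q) = d"
      using assms by auto
    with d show "x \<in> {\<Sum>k\<in>UNIV. (c(p := c p + c q)) k *\<^sub>R v k | c. \<forall>k. 0 \<le> c k}"
      by (intro CollectI exI[of _ ?c]) auto
  qed
qed

section \<open>Cones cut off by the ball of radius 2 of \<open>l1norm\<close>\<close>

definition cut_cone :: "('n \<Rightarrow> real ^ 'n) \<Rightarrow> (real ^ 'n) set" where
  "cut_cone v = nonneg_cone v \<inter> {x. l1norm x \<le> 2}"

lemma convex_cut_cone: "convex (cut_cone v)"
proof -
  have "convex {x :: real ^ 'n. l1norm x \<le> 2}"
  proof (rule convexI, clarsimp)
    fix x y :: "real ^ 'n" and s t :: real
    assume xy: "l1norm x \<le> 2" "l1norm y \<le> 2" and st: "0 \<le> s" "0 \<le> t" "s + t = 1"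
    have "l1norm (s *\<^sub>R x + t *\<^sub>R y) \<le> s * l1norm x + t * l1norm y"
      using l1norm_add_le[of "s *\<^sub>R x" "t *\<^sub>R y"] st by (simp add: l1norm_scale)
    also have "\<dots> \<le> s * 2 + t * 2"
      using xy st by (intro add_mono mult_left_mono)
    finally show "l1norm (s *\<^sub>R x + t *\<^sub>R y) \<le> 2"
      using st by (simp flip: distrib_right)
  qed
  then show ?thesis
    unfolding cut_cone_def by (intro convex_Int convex_nonneg_cone)
qed

lemma lmeasurable_cut_cone: "cut_cone v \<in> lmeasurable"
proof -
  have "bounded (cut_cone v)"
    unfolding bounded_iff cut_cone_def l1norm_def
    using norm_le_l1_cart order_trans by blast
  then show ?thesis
    by (intro measurable_convex convex_cut_cone)
qed

lemma det_update_sum: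
  fixes v :: "'n::finite \<Rightarrow> real ^ 'n"
  assumes "p \<noteq> q"
  shows "det (\<chi> k. (v(q := v p + v q)) k) = det (\<chi> k. v k)"
proof -
  have "(\<chi> k. (v(q := v p + v q)) k)
      = (\<chi> k. if k = q then row q (\<chi> k. v k) + 1 *s row p (\<chi> k. v k) else row k (\<chi> k. v k))"
    by (simp add: vec_eq_iff row_def add.commute)
  then show ?thesis
    using det_row_operation[of q p "\<chi> k. v k" 1] assms by simp
qed

text \<open>Of the coefficients of \<open>v p\<close> and \<open>v q\<close>, one is at most the
  other; each case gives one of the two cones.\<close>

lemma nonneg_cone_Un:
  assumes "p \<noteq> q"
  shows "nonneg_cone v = nonneg_cone (v(q := v p + v q)) \<union> nonneg_cone (v(p := v p + v q))"
proof -
  have "nonneg_cone v = nonneg_cone (v(q := v p + v q)) \<union> nonneg_cone (v(p := v q + v p))"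
    unfolding nonneg_cone_update_sum[OF assms] nonneg_cone_update_sum[OF assms[symmetric]]
    unfolding nonneg_cone_def using linear by blast
  then show ?thesis
    by (simp only: add.commute)
qed

text \<open>The pieces meet only where the coefficients of \<open>v p\<close> and \<open>v q\<close>
  agree. As the generators form a basis, this is a hyperplane and hence negligible.\<close>

lemma measure_cut_cone_split:
  fixes v :: "'n::finite \<Rightarrow> real ^ 'n"
  assumes "p \<noteq> q" and "det (\<chi> k. v k) \<noteq> 0"
  shows "measure lebesgue (cut_cone v) =
    measure lebesgue (cut_cone (v(q := v p + v q))) + measure lebesgue (cut_cone (v(p := v p + v q)))"
proof -
  let ?M = "\<chi> k. v k"
  have "surj ((*v) ?M)"
    using assms(2) by (simp only: invertible_det_nz[symmetric] invertible_right_inverse matrix_right_invertible_surjective)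
  \<comment> \<open>\<open>w\<close> represents the linear functional that is 1 on
    \<open>v p\<close>, -1 on \<open>v q\<close> and 0 on the other generators, so it reads off
    \<open>d p - d q\<close>.\<close>
  then obtain w where w: "?M *v w = axis p 1 - axis q 1"
    by (metis surjD)
  have vw: "v k \<bullet> w = (axis p 1 - axis q 1) $ k" for k
    using arg_cong[OF w, of "\<lambda>x. x $ k"] by (simp add: matrix_vector_mul_component)
  then have "w \<bullet> (\<Sum>k\<in>UNIV. d k *\<^sub>R v k) = (\<Sum>k\<in>UNIV. d k * (axis p 1 - axis q 1) $ k)" for d
    by (simp add: inner_sum_right inner_commute)
  also have "\<dots> d = (\<Sum>k\<in>UNIV. (if k = p then d k else 0) - (if k = q then d k else 0))" for d
    by (intro sum.cong) (auto simp: axis_def)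
  finally have wd: "w \<bullet> (\<Sum>k\<in>UNIV. d k *\<^sub>R v k) = d p - d q" for d
    by (simp add: sum_subtractf)
  have "w \<noteq> 0"
    using vw[of p] assms(1) by (auto simp: axis_def)
  have "cut_cone (v(q := v p + v q)) \<inter> cut_cone (v(p := v q + v p)) \<subseteq> {x. w \<bullet> x = 0}"
    unfolding cut_cone_def nonneg_cone_update_sum[OF assms(1)] nonneg_cone_update_sum[OF assms(1)[symmetric]]
    by (smt (verit) IntE mem_Collect_eq subsetI wd)
  then have "negligible (cut_cone (v(q := v p + v q)) \<inter> cut_cone (v(p := v p + v q)))"
    using negligible_hyperplane[of w 0] \<open>w \<noteq> 0\<close> by (metis add.commute negligible_subset)
  moreover have "cut_cone v = cut_cone (v(q := v p + v q)) \<union> cut_cone (v(p := v p + v q))"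
    unfolding cut_cone_def using nonneg_cone_Un[OF assms(1), of v] by blast
  ultimately show ?thesis
    by (auto simp: measure_Un3 lmeasurable_cut_cone negligible_imp_measure0)
qed

text \<open>Without cancellation in any coordinate, \<open>l1norm\<close> is additive on the cone.
  The norm of a combination is then twice its coefficient sum, and the bound 2 says that this sum is
  at most 1.\<close>

lemma cut_cone_eq_simplex:
  fixes v :: "'n::finite \<Rightarrow> real ^ 'n"
  assumes same_sign: "\<And>i k l. \<not> (v k $ i < 0 \<and> 0 < v l $ i)"
    and norm: "\<And>k. l1norm (v k) = 2"
  shows "cut_cone v = convex hull (insert 0 (range v))"
proof
  have "0 \<in> cut_cone v"
    using nonneg_coneI[of "\<lambda>_. 0" 0 v] by (simp add: cut_cone_def l1norm_def)
  moreover have "range v \<subseteq> cut_cone v"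
    using norm generator_in_nonneg_cone by (auto simp: cut_cone_def)
  ultimately show "convex hull (insert 0 (range v)) \<subseteq> cut_cone v"
    by (intro hull_minimal) (auto simp: convex_cut_cone)
next
  show "cut_cone v \<subseteq> convex hull (insert 0 (range v))"
  proof
    fix x assume "x \<in> cut_cone v"
    then obtain c where c: "\<And>k. 0 \<le> c k" and x: "x = (\<Sum>k\<in>UNIV. c k *\<^sub>R v k)" and le: "l1norm x \<le> 2"
      unfolding cut_cone_def nonneg_cone_def by auto
    define S where "S = sum c UNIV"
    have "\<bar>x $ i\<bar> = (\<Sum>k\<in>UNIV. c k * \<bar>v k $ i\<bar>)" for i
    proof (cases "\<exists>k. v k $ i < 0")
      case True
      with same_sign have "v k $ i \<le> 0" for k
        by (meson not_le)
      then show ?thesis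
        using c by (simp add: x abs_of_nonpos sum_nonpos mult_nonneg_nonpos sum_negf)
    next
      case False
      then have "0 \<le> v k $ i" for k
        by (meson not_le)
      then show ?thesis
        using c by (simp add: x abs_of_nonneg sum_nonneg)
    qed
    then have "l1norm x = (\<Sum>k\<in>UNIV. c k * l1norm (v k))"
      unfolding l1norm_def by (simp add: sum_distrib_left) (rule sum.swap)
    then have "S \<le> 1"
      using le by (simp add: norm S_def flip: sum_distrib_right)
    have "0 \<le> S"
      using c by (simp add: S_def sum_nonneg)
    let ?H = "convex hull (insert 0 (range v))"
    show "x \<in> ?H"
    proof (cases "S = 0")
      case True
      then have "c k = 0" for k
        using c by (simp add: S_def sum_nonneg_eq_0_iff)
      then show ?thesis
        by (simp add: x hull_inc)
    next
      case False
      have "(\<Sum>k\<in>UNIV. (c k / S) *\<^sub>R v k) \<in> ?H"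
        using c False \<open>0 \<le> S\<close>
        by (intro convex_sum convex_convex_hull) (auto simp: hull_inc S_def simp flip: sum_divide_distrib)
      \<comment> \<open>The vertex 0 takes up the remaining weight \<open>1 - S\<close>.\<close>
      then have "S *\<^sub>R (\<Sum>k\<in>UNIV. (c k / S) *\<^sub>R v k) + (1 - S) *\<^sub>R 0 \<in> ?H"
        using \<open>0 \<le> S\<close> \<open>S \<le> 1\<close> by (intro convexD convex_convex_hull) (auto simp: hull_inc)
      then show ?thesis
        using False by (simp add: x scaleR_sum_right)
    qed
  qed
qed

subsection \<open>Reductions of signed graphs\<close>

definition valid_edge :: "'n::linorder edge \<Rightarrow> bool" where
  "valid_edge e \<longleftrightarrow> (case e of (i, j, s) \<Rightarrow> i \<le> j \<and> (i = j \<longrightarrow> s = Positive))"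

lemma l1norm_edge_vec:
  assumes "valid_edge e"
  shows "l1norm (edge_vec e) = 2"
proof -
  obtain i j s where e: "e = (i, j, s)"
    by (cases e)
  have "\<bar>edge_vec e $ k\<bar> = (if k = i then 1 else 0) + (if k = j then 1 else 0)" for k
    using assms by (cases s) (auto simp: e valid_edge_def axis_def)
  then show ?thesis
    by (simp add: l1norm_def sum.distrib)
qed

lemma edge_vec_in_positive_roots:
  assumes "valid_edge e"
  shows "edge_vec e \<in> positive_roots"
proof (cases e rule: edge_vec.cases)
  case (1 i j)
  then have "i < j"
    using assms by (auto simp: valid_edge_def)
  then show ?thesis
    unfolding 1 edge_vec.simps positive_roots_def by blast
next
  case (2 i j)
  then show ?thesis
  proof (cases "i = j")
    case True
    then show ?thesis
      unfolding 2 edge_vec.simps positive_roots_def by (auto simp flip: scaleR_2)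
  next
    case False
    then have "i < j"
      using assms 2 by (simp add: valid_edge_def)
    then show ?thesis
      unfolding 2 edge_vec.simps positive_roots_def by blast
  qed
qed

lemma l1norm_positive_root:
  assumes "x \<in> positive_roots"
  shows "l1norm x = 2"
proof -
  have "\<exists>e. valid_edge e \<and> x = edge_vec e"
    using assms unfolding positive_roots_def
  proof (elim UnE CollectE exE conjE)
    fix i j assume "x = axis i 1 - axis j 1" "i < j"
    then show ?thesis
      by (intro exI[of _ "(i, j, Negative)"]) (auto simp: valid_edge_def)
  next
    fix i j assume "x = axis i 1 + axis j 1" "i < j"
    then show ?thesis
      by (intro exI[of _ "(i, j, Positive)"]) (auto simp: valid_edge_def)
  next
    fix k assume "x = 2 *\<^sub>R axis k 1"
    then show ?thesis
      by (intro exI[of _ "(k, k, Positive)"]) (auto simp: valid_edge_def scaleR_2)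
  qed
  then show ?thesis
    using l1norm_edge_vec by blast
qed

text \<open>Additivity lets all six rules be treated alike, as one row operation and one subdivision
  of a cone.\<close>

lemma reduction_rule_new_edge:
  assumes "reduction_rule a b c"
  shows "edge_vec c = edge_vec a + edge_vec b" "valid_edge c"
  using assms by (auto elim!: reduction_rule.cases simp: valid_edge_def)

lemma reduction_rule_distinct: "reduction_rule a b c \<Longrightarrow> a \<noteq> b"
  by (auto elim: reduction_rule.cases)

text \<open>A negative entry at \<open>j\<close> forces \<open>e = (i, j, Negative)\<close>. If
  \<open>j\<close> is the smaller endpoint of \<open>e'\<close>, R1 or R2 applies; if it is the
  larger one, comparing the other endpoint with \<open>i\<close> selects R3, R4 or R5; a loop gives
  R6. The disjunction is there because R4 lists the positive edge first.\<close>

lemma opposite_signs_reducible: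
  assumes "valid_edge e" "valid_edge e'" "edge_vec e $ j < 0" "0 < edge_vec e' $ j"
  shows "\<exists>c. reduction_rule e e' c \<or> reduction_rule e' e c"
proof -
  obtain i where e: "e = (i, j, Negative)" and "i < j"
    using assms(1,3) by (cases e rule: edge_vec.cases) (auto simp: valid_edge_def axis_def split: if_splits)
  consider m s where "e' = (j, m, s)" "j < m" | m where "e' = (m, j, Positive)" "m < j"
    | "e' = (j, j, Positive)"
    using assms(2,4)
    by (cases e' rule: edge_vec.cases) (auto simp: valid_edge_def axis_def split: if_splits)
  then show ?thesis
  proof cases
    case (1 m s)
    then show ?thesis
      using \<open>i < j\<close> e by (cases s) (blast intro: R1 R2)+
  next
    case (2 m)
    then show ?thesis
      using \<open>i < j\<close> e by (cases m i rule: linorder_cases) (blast intro: R3 R4 R5)+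
  next
    case 3
    then show ?thesis
      using \<open>i < j\<close> e by (blast intro: R6)
  qed
qed

text \<open>Edges are numbered by the vertex type itself, so that the matrix of edge vectors is
  square.\<close>

abbreviation graph_of :: "('n \<Rightarrow> 'n edge) \<Rightarrow> 'n::finite sgraph" where
  "graph_of f \<equiv> image_mset f (mset_set UNIV)"

lemma graph_of_update:
  "graph_of (f(q := c)) = graph_of f - {#f q#} + {#c#}"
proof -
  have "mset_set UNIV = add_mset q (mset_set (UNIV - {q}))"
    by (rule mset_set.remove) auto
  moreover have "image_mset (f(q := c)) (mset_set (UNIV - {q})) = image_mset f (mset_set (UNIV - {q}))"
    by (intro image_mset_cong) auto
  ultimately show ?thesis
    by simp
qed

lemma edge_cone_graph_of:
  assumes "inj f"
  shows "edge_cone (graph_of f) = nonneg_cone (edge_vec \<circ> f)"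
proof -
  have eq: "(\<Sum>e\<in>range f. c e *\<^sub>R edge_vec e) = (\<Sum>k\<in>UNIV. c (f k) *\<^sub>R edge_vec (f k))" for c
    using sum.reindex[OF assms, of "\<lambda>e. c e *\<^sub>R edge_vec e"] by simp
  show ?thesis
  proof (intro equalityI subsetI)
    fix x assume "x \<in> edge_cone (graph_of f)"
    then show "x \<in> nonneg_cone (edge_vec \<circ> f)"
      unfolding edge_cone_def nonneg_cone_def by (auto simp: eq)
  next
    fix x assume "x \<in> nonneg_cone (edge_vec \<circ> f)"
    then obtain c where "\<forall>k. 0 \<le> c k" "x = (\<Sum>k\<in>UNIV. c k *\<^sub>R edge_vec (f k))"
      unfolding nonneg_cone_def by auto
    then show "x \<in> edge_cone (graph_of f)"
      unfolding edge_cone_def using assms by (auto simp: eq intro!: exI[of _ "c \<circ> inv f"])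
  qed
qed

text \<open>This inclusion needs only that roots have norm 2 and that the truncated cone is convex.
  The converse is obtained by induction over a reduction tree.\<close>

lemma root_polytope_subset_cut_cone:
  assumes "inj f"
  shows "root_polytope (graph_of f) \<subseteq> cut_cone (edge_vec \<circ> f)"
  unfolding root_polytope_def edge_cone_graph_of[OF assms]
proof (rule hull_minimal)
  show "insert 0 (positive_roots \<inter> nonneg_cone (edge_vec \<circ> f)) \<subseteq> cut_cone (edge_vec \<circ> f)"
    using nonneg_coneI[of "\<lambda>_. 0" 0 "edge_vec \<circ> f"]
    by (auto simp: cut_cone_def l1norm_positive_root) (simp add: l1norm_def)
qed (rule convex_cut_cone)

lemma det_nonzero_of_independent:
  fixes v :: "'n::finite \<Rightarrow> real ^ 'n"
  assumes "inj v" "independent (range v)"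
  shows "det (\<chi> k. v k) \<noteq> 0"
proof -
  have "c k = 0" if "(\<Sum>i\<in>UNIV. c i *s row i (\<chi> k. v k)) = 0" for c k
  proof -
    have "(\<Sum>x\<in>range v. c (inv v x) *\<^sub>R x) = (\<Sum>i\<in>UNIV. c i *\<^sub>R v i)"
      using assms(1) by (simp add: sum.reindex)
    also have "\<dots> = 0"
      using that by (simp add: row_def scalar_mult_eq_scaleR)
    finally have "c (inv v (v k)) = 0"
      by (intro independentD[OF assms(2), of "range v" "\<lambda>x. c (inv v x)"]) auto
    then show ?thesis
      using assms(1) by simp
  qed
  then show ?thesis
    unfolding invertible_det_nz[symmetric] invertible_right_inverse matrix_right_invertible_independent_rows
    by blast
qed

lemma reduces_size:
  assumes "reduces G G1 G2 G3"
  shows "size G1 \<le> size G" "size G2 \<le> size G" "size G3 < size G"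
proof -
  obtain a b c where r: "reduction_rule a b c" "a \<in># G" "b \<in># G"
      and G: "G1 = G - {#b#} + {#c#}" "G2 = G - {#a#} + {#c#}" "G3 = G - {#a, b#} + {#c#}"
    using assms unfolding reduces_def by blast
  \<comment> \<open>As \<open>a\<close> and \<open>b\<close> differ, removing both really deletes
    two edges, so the third child has one edge fewer.\<close>
  have "b \<in># G - {#a#}"
    using r reduction_rule_distinct[OF r(1)] by (simp add: in_diff_count)
  then obtain G' where "G - {#a#} = add_mset b G'"
    by (rule mset_add)
  then have "G = {#a, b#} + G'"
    using insert_DiffM[OF r(2)] by simp
  then show "size G1 \<le> size G" "size G2 \<le> size G" "size G3 < size G"
    by (auto simp: G)
qed

lemma leaf_labels_size_le:
  "S_reduction_tree t \<Longrightarrow> G \<in># leaf_labels t \<Longrightarrow> size G \<le> size (root_label t)"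
proof (induction t)
  case (Node H t1 t2 t3)
  then have trees: "S_reduction_tree t1" "S_reduction_tree t2" "S_reduction_tree t3"
    and red: "reduces H (root_label t1) (root_label t2) (root_label t3)"
    by auto
  from Node.prems(2) consider "G \<in># leaf_labels t1" | "G \<in># leaf_labels t2" | "G \<in># leaf_labels t3"
    by auto
  then have "size G \<le> size H"
    by cases (use Node.IH trees reduces_size[OF red] in \<open>meson le_trans less_imp_le\<close>)+
  then show ?case
    by simp
qed auto

text \<open>Reductions never add edges in total. This is why the third subtree of a node contributes
  nothing to the count.\<close>

lemma num_full_leaves_eq_0:
  fixes t :: "'n::{finite,linorder} rtree"
  assumes "S_reduction_tree t" "size (root_label t) < CARD('n)"
  shows "num_full_leaves t = 0"
proof -
  have "size G \<noteq> CARD('n)" if "G \<in># leaf_labels t" for G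
    using leaf_labels_size_le[OF assms(1) that] assms(2) by simp
  then show ?thesis
    by (simp add: num_full_leaves_def)
qed

lemma num_full_leaves_Node:
  "num_full_leaves (Node G t1 t2 t3) = num_full_leaves t1 + num_full_leaves t2 + num_full_leaves t3"
  by (simp add: num_full_leaves_def)

section \<open>Polytope and volume along a reduction tree\<close>

lemma root_polytope_mono:
  "edge_cone G \<subseteq> edge_cone H \<Longrightarrow> root_polytope G \<subseteq> root_polytope H"
  unfolding root_polytope_def by (intro hull_mono) auto

text \<open>The inclusion holds at a leaf because the vertices of the simplex are roots, and it
  passes upwards because the first two children cover the truncated cone and their polytopes lie in
  that of the parent. The volume adds up over these children, which keep the determinant.\<close>

lemma cut_cone_reduction_tree:
  fixes T :: "'n::{finite,linorder} rtree" and f :: "'n \<Rightarrow> 'n edge"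
  assumes "S_reduction_tree T" "root_label T = graph_of f" "\<And>k. valid_edge (f k)"
    and "det (\<chi> k. (edge_vec \<circ> f) k) \<noteq> 0"
  shows "cut_cone (edge_vec \<circ> f) \<subseteq> root_polytope (graph_of f) \<and>
    measure lebesgue (cut_cone (edge_vec \<circ> f))
      = \<bar>det (\<chi> k. (edge_vec \<circ> f) k)\<bar> * num_full_leaves T / fact CARD('n)"
  using assms
proof (induction T arbitrary: f)
  case (Leaf G)
  let ?v = "edge_vec \<circ> f"
  have G: "G = graph_of f"
    using Leaf.prems by simp
  have inj: "inj f"
    using inj_of_det[OF Leaf.prems(4)] by (rule inj_on_imageI2)
  \<comment> \<open>Irreducibility excludes opposite signs at a vertex, which is what makes the
    truncated cone a simplex.\<close>
  have "\<not> (?v k $ i < 0 \<and> 0 < ?v l $ i)" for i k l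
  proof
    have irreducible: "\<not> reduction_rule a b c" if "a \<in># G" "b \<in># G" for a b c
    proof
      assume "reduction_rule a b c"
      with that have "\<exists>G1 G2 G3. reduces G G1 G2 G3"
        unfolding reduces_def by blast
      with Leaf.prems(1) show False
        by simp
    qed
    assume "?v k $ i < 0 \<and> 0 < ?v l $ i"
    then obtain c where "reduction_rule (f k) (f l) c \<or> reduction_rule (f l) (f k) c"
      using opposite_signs_reducible[of "f k" "f l" i] Leaf.prems(3) by auto
    then show False
      using irreducible[of "f k" "f l" c] irreducible[of "f l" "f k" c] by (simp add: G)
  qed
  then have simplex: "cut_cone ?v = convex hull (insert 0 (range ?v))"
    using Leaf.prems(3) by (intro cut_cone_eq_simplex) (auto simp: l1norm_edge_vec)
  have "range ?v \<subseteq> positive_roots \<inter> edge_cone (graph_of f)"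
    using Leaf.prems(3) edge_cone_graph_of[OF inj] generator_in_nonneg_cone[of ?v]
    by (auto simp: edge_vec_in_positive_roots)
  then have "cut_cone ?v \<subseteq> root_polytope (graph_of f)"
    unfolding simplex root_polytope_def by (intro hull_mono) auto
  \<comment> \<open>The leaf counts because \<open>graph_of f\<close> has one edge for each
    index.\<close>
  moreover have "num_full_leaves (Leaf G) = 1"
    by (simp add: num_full_leaves_def G)
  moreover have "measure lebesgue (cut_cone ?v) = \<bar>det (\<chi> k. ?v k)\<bar> / fact CARD('n)"
    unfolding simplex by (rule measure_simplex[OF Leaf.prems(4)])
  ultimately show ?case
    by (simp only: of_nat_1 mult_1_right simp_thms)
next
  case (Node G t1 t2 t3)
  let ?v = "edge_vec \<circ> f"
  have G: "G = graph_of f"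
    using Node.prems by simp
  have red: "reduces G (root_label t1) (root_label t2) (root_label t3)"
    and trees: "S_reduction_tree t1" "S_reduction_tree t2" "S_reduction_tree t3"
    using Node.prems(1) by auto
  then obtain p q c where rule: "reduction_rule (f p) (f q) c"
      and labels: "root_label t1 = graph_of f - {#f q#} + {#c#}" "root_label t2 = graph_of f - {#f p#} + {#c#}"
    unfolding reduces_def by (auto simp: G)
  have "p \<noteq> q"
    using reduction_rule_distinct[OF rule] by auto
  let ?f1 = "f(q := c)" and ?f2 = "f(p := c)"
  have v: "edge_vec \<circ> ?f1 = ?v(q := ?v p + ?v q)" "edge_vec \<circ> ?f2 = ?v(p := ?v p + ?v q)"
    using reduction_rule_new_edge(1)[OF rule] by auto
  have det: "det (\<chi> k. (edge_vec \<circ> ?f1) k) = det (\<chi> k. ?v k)" "det (\<chi> k. (edge_vec \<circ> ?f2) k) = det (\<chi> k. ?v k)"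
    unfolding v using det_update_sum[OF \<open>p \<noteq> q\<close>, of ?v] det_update_sum[of q p ?v] \<open>p \<noteq> q\<close>
    by (auto simp: add.commute)
  have valid: "valid_edge (?f1 k)" "valid_edge (?f2 k)" for k
    using Node.prems(3) reduction_rule_new_edge(2)[OF rule] by auto
  have IH1: "cut_cone (edge_vec \<circ> ?f1) \<subseteq> root_polytope (graph_of ?f1) \<and>
      measure lebesgue (cut_cone (edge_vec \<circ> ?f1))
        = \<bar>det (\<chi> k. (edge_vec \<circ> ?f1) k)\<bar> * num_full_leaves t1 / fact CARD('n)"
    using Node.prems(4) valid by (intro Node.IH(1) trees) (simp_all only: labels graph_of_update det not_False_eq_True)
  have IH2: "cut_cone (edge_vec \<circ> ?f2) \<subseteq> root_polytope (graph_of ?f2) \<and>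
      measure lebesgue (cut_cone (edge_vec \<circ> ?f2))
        = \<bar>det (\<chi> k. (edge_vec \<circ> ?f2) k)\<bar> * num_full_leaves t2 / fact CARD('n)"
    using Node.prems(4) valid by (intro Node.IH(2) trees) (simp_all only: labels graph_of_update det not_False_eq_True)
  have inj: "inj f" "inj ?f1" "inj ?f2"
    using Node.prems(4) by (auto intro!: inj_on_imageI2[of edge_vec] inj_of_det simp only: det)
  have cone: "nonneg_cone ?v = nonneg_cone (edge_vec \<circ> ?f1) \<union> nonneg_cone (edge_vec \<circ> ?f2)"
    unfolding v by (rule nonneg_cone_Un[OF \<open>p \<noteq> q\<close>])
  then have "root_polytope (graph_of ?f1) \<subseteq> root_polytope (graph_of f)"
    "root_polytope (graph_of ?f2) \<subseteq> root_polytope (graph_of f)"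
    using inj by (auto intro!: root_polytope_mono simp: edge_cone_graph_of simp del: fun_upd_apply)
  moreover have "cut_cone ?v = cut_cone (edge_vec \<circ> ?f1) \<union> cut_cone (edge_vec \<circ> ?f2)"
    using cone by (auto simp: cut_cone_def)
  ultimately have "cut_cone ?v \<subseteq> root_polytope (graph_of f)"
    using IH1 IH2 by blast
  moreover have "num_full_leaves t3 = 0"
    using reduces_size(3)[OF red] trees(3) by (intro num_full_leaves_eq_0) (simp_all add: G)
  moreover have "measure lebesgue (cut_cone ?v) =
      measure lebesgue (cut_cone (edge_vec \<circ> ?f1)) + measure lebesgue (cut_cone (edge_vec \<circ> ?f2))"
    unfolding v by (rule measure_cut_cone_split[OF \<open>p \<noteq> q\<close> Node.prems(4)])
  ultimately show ?case
    using IH1 IH2 unfolding det by (simp add: num_full_leaves_Node add_divide_distrib distrib_left del: o_apply)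
qed

lemma ex_graph_of:
  fixes G :: "'n::finite sgraph"
  assumes "size G = CARD('n)"
  obtains f where "G = graph_of f"
proof -
  have "finite A \<Longrightarrow> card A = size G \<Longrightarrow> \<exists>f. image_mset f (mset_set A) = G" for A :: "'n set"
  proof (induction A arbitrary: G rule: finite_induct)
    case (insert a A)
    then obtain e G' where G: "G = add_mset e G'"
      by (metis card.insert nat.distinct(1) size_empty multiset_cases)
    with insert obtain f where "image_mset f (mset_set A) = G'"
      by fastforce
    moreover have "image_mset (f(a := e)) (mset_set A) = image_mset f (mset_set A)"
      using insert.hyps by (intro image_mset_cong) auto
    ultimately show ?case
      using insert.hyps by (intro exI[of _ "f(a := e)"]) (simp add: G del: fun_upd_apply, simp)
  qed simp
  from this[of UNIV] assms that show ?thesis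
    by auto
qed

theorem proposition10:
  fixes G0 :: "'n::{finite,linorder} sgraph" and T :: "'n rtree"
  assumes "G0 \<in> indep_sgraphs"
    and "connected_sgraph G0"
    and "size G0 = CARD('n)"
    and "S_reduction_tree T"
    and "root_label T = G0"
  shows "measure lebesgue (root_polytope G0) = 2 * real (num_full_leaves T) / fact CARD('n)"
proof -
  obtain f where G0: "G0 = graph_of f"
    using assms(3) by (rule ex_graph_of)
  let ?v = "edge_vec \<circ> f"
  have "inj ?v"
  proof (rule injI, rule ccontr)
    fix k l assume kl: "?v k = ?v l" "k \<noteq> l"
    \<comment> \<open>Two distinct indices with the same vector would give it multiplicity at least
      2 in the family of edge vectors.\<close>
    have "mset_set UNIV = {#k, l#} + mset_set (UNIV - {k, l})"
      using kl(2) mset_set_Union[of "{k, l}" "UNIV - {k, l}"] by simp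
    then have "2 \<le> count (image_mset edge_vec G0) (?v k)"
      using kl(1) by (simp add: G0)
    moreover have "count (image_mset edge_vec G0) (?v k) \<le> 1"
      using assms(1) by (simp add: indep_sgraphs_def)
    ultimately show False
      by simp
  qed
  moreover have "independent (range ?v)"
    using assms(1) by (simp add: indep_sgraphs_def G0 image_comp)
  ultimately have det: "det (\<chi> k. ?v k) \<noteq> 0"
    by (rule det_nonzero_of_independent)
  have valid: "valid_edge (f k)" for k
    using assms(1) by (auto simp: indep_sgraphs_def signed_graph_def valid_edge_def G0)
  have "equivclp (\<lambda>i j. \<exists>t. (i, j, t) \<in> range f) u v" for u v
    using assms(2) by (simp add: connected_sgraph_def G0)
  then have two: "\<bar>det (\<chi> k. ?v k)\<bar> = 2"
    using det unfolding o_apply by (rule det_connected)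
  have "inj f"
    using \<open>inj ?v\<close> by (rule inj_on_imageI2)
  note tree = cut_cone_reduction_tree[OF assms(4) assms(5)[unfolded G0] valid det]
  have "root_polytope G0 = cut_cone ?v"
    unfolding G0 using root_polytope_subset_cut_cone[OF \<open>inj f\<close>] conjunct1[OF tree]
    by (rule equalityI)
  then show ?thesis
    using conjunct2[OF tree] by (simp only: two)
qed

end
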